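(* Let $A$ be a commutative ring with nonzero identity, let $M$ be an $A$-module and let $F$ be a flat $A$-module. If $P$ is a classical 1-absorbing prime submodule of $M$ such that $F\otimes P\neq F\otimes M$, then $F\otimes P$ is a classical 1-absorbing prime submodule of the $A$-module $F\otimes M$.
   Context: All rings are commutative with nonzero identity; the given modules are nonzero and unital. Tensor products are over $A$; since $F$ is flat, $F\otimes P$ is regarded as a submodule of $F\otimes M$ via the injective map induced by the inclusion $P\subseteq M$. A proper submodule $P$ of an $A$-module $M$ is a classical 1-absorbing prime submodule if whenever $abcm\in P$ for nonunits $a,b,c\in A$ and $m\in M$, then $abm\in P$ or $cm\in P$. *)

theory Defs
  imports "HOL-Algebra.Module" "HOL-Algebra.AbelCoset" "HOL.Hull"
begin

definition module_hom ::
  "('a, 'r) ring_scheme \<Rightarrow> ('a, 'n, 'x) module_scheme \<Rightarrow> ('a, 'm, 'y) module_scheme \<Rightarrow> ('n \<Rightarrow> 'm) set"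
  where "module_hom A N M =
    {g \<in> hom (add_monoid N) (add_monoid M).
       \<forall>a\<in>carrier A. \<forall>x\<in>carrier N. g (a \<odot>\<^bsub>N\<^esub> x) = a \<odot>\<^bsub>M\<^esub> g x}"

text \<open>
  The record type of modules extends that of rings. Its multiplicative fields play no role for a
  module, so they are left unspecified below.
\<close>

definition free_module :: "('a, 'r) ring_scheme \<Rightarrow> 's set \<Rightarrow> ('a, 's \<Rightarrow> 'a) module"
  where "free_module A S =
    \<lparr>carrier = {u. u \<in> S \<rightarrow> carrier A \<and> (\<forall>s. s \<notin> S \<longrightarrow> u s = \<zero>\<^bsub>A\<^esub>) \<and> finite {s. u s \<noteq> \<zero>\<^bsub>A\<^esub>}},
     mult = undefined, one = undefined,
     zero = (\<lambda>s. \<zero>\<^bsub>A\<^esub>), add = (\<lambda>u v s. u s \<oplus>\<^bsub>A\<^esub> v s),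
     smult = (\<lambda>a u s. a \<otimes>\<^bsub>A\<^esub> u s)\<rparr>"

definition free_gen :: "('a, 'r) ring_scheme \<Rightarrow> 's \<Rightarrow> 's \<Rightarrow> 'a"
  where "free_gen A s = (\<lambda>t. if t = s then \<one>\<^bsub>A\<^esub> else \<zero>\<^bsub>A\<^esub>)"

text \<open>The linear map between free modules that sends the generator \<open>s\<close> to the generator \<open>\<phi> s\<close>.\<close>

definition free_map :: "('a, 'r) ring_scheme \<Rightarrow> ('s \<Rightarrow> 't) \<Rightarrow> ('s \<Rightarrow> 'a) \<Rightarrow> 't \<Rightarrow> 'a"
  where "free_map A \<phi> u = (\<lambda>t. \<Oplus>\<^bsub>A\<^esub>s\<in>{s. u s \<noteq> \<zero>\<^bsub>A\<^esub> \<and> \<phi> s = t}. u s)"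

definition quotient_module :: "('a, 'm, 'x) module_scheme \<Rightarrow> 'm set \<Rightarrow> ('a, 'm set) module"
  where "quotient_module M N =
    \<lparr>carrier = a_rcosets\<^bsub>M\<^esub> N,
     mult = undefined, one = undefined,
     zero = N, add = (\<lambda>X Y. X <+>\<^bsub>M\<^esub> Y),
     smult = (\<lambda>a X. \<Union>x\<in>X. N +>\<^bsub>M\<^esub> (a \<odot>\<^bsub>M\<^esub> x))\<rparr>"

abbreviation tensor_free ::
  "('a, 'r) ring_scheme \<Rightarrow> ('a, 'f, 'x) module_scheme \<Rightarrow> ('a, 'm, 'y) module_scheme
    \<Rightarrow> ('a, 'f \<times> 'm \<Rightarrow> 'a) module"
  where "tensor_free A F M \<equiv> free_module A (carrier F \<times> carrier M)"

definition tensor_rels ::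
  "('a, 'r) ring_scheme \<Rightarrow> ('a, 'f, 'x) module_scheme \<Rightarrow> ('a, 'm, 'y) module_scheme
    \<Rightarrow> ('f \<times> 'm \<Rightarrow> 'a) set"
  where "tensor_rels A F M = (let C = tensor_free A F M; e = free_gen A in
      {e (f \<oplus>\<^bsub>F\<^esub> f', m) \<ominus>\<^bsub>C\<^esub> (e (f, m) \<oplus>\<^bsub>C\<^esub> e (f', m)) | f f' m.
         f \<in> carrier F \<and> f' \<in> carrier F \<and> m \<in> carrier M} \<union>
      {e (f, m \<oplus>\<^bsub>M\<^esub> m') \<ominus>\<^bsub>C\<^esub> (e (f, m) \<oplus>\<^bsub>C\<^esub> e (f, m')) | f m m'.
         f \<in> carrier F \<and> m \<in> carrier M \<and> m' \<in> carrier M} \<union>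
      {e (a \<odot>\<^bsub>F\<^esub> f, m) \<ominus>\<^bsub>C\<^esub> a \<odot>\<^bsub>C\<^esub> e (f, m) | a f m.
         a \<in> carrier A \<and> f \<in> carrier F \<and> m \<in> carrier M} \<union>
      {e (f, a \<odot>\<^bsub>M\<^esub> m) \<ominus>\<^bsub>C\<^esub> a \<odot>\<^bsub>C\<^esub> e (f, m) | a f m.
         a \<in> carrier A \<and> f \<in> carrier F \<and> m \<in> carrier M})"

definition tensor_ker ::
  "('a, 'r) ring_scheme \<Rightarrow> ('a, 'f, 'x) module_scheme \<Rightarrow> ('a, 'm, 'y) module_scheme
    \<Rightarrow> ('f \<times> 'm \<Rightarrow> 'a) set"
  where "tensor_ker A F M = (\<lambda>H. submodule H A (tensor_free A F M)) hull tensor_rels A F M"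

definition tensor ::
  "('a, 'r) ring_scheme \<Rightarrow> ('a, 'f, 'x) module_scheme \<Rightarrow> ('a, 'm, 'y) module_scheme
    \<Rightarrow> ('a, ('f \<times> 'm \<Rightarrow> 'a) set) module"
  where "tensor A F M = quotient_module (tensor_free A F M) (tensor_ker A F M)"

text \<open>The map \<open>id \<otimes> g\<close> from \<open>F \<otimes> N\<close> to \<open>F \<otimes> M\<close> induced by a linear map \<open>g\<close> from \<open>N\<close> to \<open>M\<close>:
  it sends the class of \<open>u\<close> to the class of \<open>free_map A (\<lambda>(f, n). (f, g n)) u\<close>.\<close>

definition tensor_map ::
  "('a, 'r) ring_scheme \<Rightarrow> ('a, 'f, 'x) module_scheme \<Rightarrow> ('a, 'm, 'y) module_scheme
    \<Rightarrow> ('n \<Rightarrow> 'm) \<Rightarrow> ('f \<times> 'n \<Rightarrow> 'a) set \<Rightarrow> ('f \<times> 'm \<Rightarrow> 'a) set"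
  where "tensor_map A F M g X =
    (\<Union>u\<in>X. tensor_ker A F M +>\<^bsub>tensor_free A F M\<^esub> free_map A (\<lambda>(f, n). (f, g n)) u)"

text \<open>The submodule \<open>F \<otimes> P\<close> of \<open>F \<otimes> M\<close>, i.e. the image of the map induced by the inclusion.\<close>

definition tensor_submodule ::
  "('a, 'r) ring_scheme \<Rightarrow> ('a, 'f, 'x) module_scheme \<Rightarrow> ('a, 'm, 'y) module_scheme
    \<Rightarrow> 'm set \<Rightarrow> ('f \<times> 'm \<Rightarrow> 'a) set set"
  where "tensor_submodule A F M P =
    tensor_map A F M (\<lambda>p. p) ` carrier (tensor A F (M\<lparr>carrier := P\<rparr>))"

text \<open>
  Flatness: tensoring with \<open>F\<close> preserves injectivity of linear maps. A formula cannot quantify over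
  types, so the type \<open>'n\<close> carrying the test modules is a parameter. It matters only through its
  size: by the ideal criterion (only inclusions of ideals into the ring need testing), all choices
  of \<open>'n\<close> into which the type \<open>'a\<close> of the ring embeds give the same, usual, notion. If \<open>'n\<close> is too
  small (e.g. the unit type), the notion is degenerate.
\<close>

definition flat_module ::
  "'n itself \<Rightarrow> ('a, 'r) ring_scheme \<Rightarrow> ('a, 'f, 'x) module_scheme \<Rightarrow> bool"
  where "flat_module _ A F \<longleftrightarrow> module A F \<and>
    (\<forall>(N' :: ('a, 'n) module) (N :: ('a, 'n) module) g.
       module A N' \<longrightarrow> module A N \<longrightarrow> g \<in> module_hom A N' N \<longrightarrow> inj_on g (carrier N') \<longrightarrow>
       inj_on (tensor_map A F N g) (carrier (tensor A F N')))"

locale classical_1_absorbing_prime_submodule = module A M + submodule P A M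
  for A (structure) and M (structure) and P +
  assumes proper: "P \<noteq> carrier M"
    and absorbing:
      "\<lbrakk>a \<in> carrier A - Units A; b \<in> carrier A - Units A; c \<in> carrier A - Units A; m \<in> carrier M;
        (a \<otimes>\<^bsub>A\<^esub> b \<otimes>\<^bsub>A\<^esub> c) \<odot>\<^bsub>M\<^esub> m \<in> P\<rbrakk>
       \<Longrightarrow> (a \<otimes>\<^bsub>A\<^esub> b) \<odot>\<^bsub>M\<^esub> m \<in> P \<or> c \<odot>\<^bsub>M\<^esub> m \<in> P"

end

theory Submission
  imports Defs
begin

text \<open>
  Write \<open>(P : a) = {m. a m \<in> P}\<close>. The absorbing condition on \<open>P\<close> says that for nonunits \<open>a, b, c\<close>
  the submodule \<open>(P : abc)\<close> is contained in the union of \<open>(P : ab)\<close> and \<open>(P : c)\<close>. A submodule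
  contained in a union of two submodules is contained in one of them, so one of the two works for
  all elements \<open>m\<close> at once (\<open>colon_dichotomy\<close>). This uniform version passes to \<open>F \<otimes> M\<close> although
  its elements are sums of pure tensors, because for flat \<open>F\<close> the formation of colons commutes
  with tensoring, \<open>(F \<otimes> P : a) = F \<otimes> (P : a)\<close>: if \<open>abc z \<in> F \<otimes> P\<close> then \<open>z \<in> F \<otimes> (P : abc)\<close>,
  which lies in \<open>F \<otimes> (P : ab)\<close> or in \<open>F \<otimes> (P : c)\<close>, hence \<open>ab z\<close> or \<open>c z\<close> lies in \<open>F \<otimes> P\<close>.

  The inclusion of \<open>F \<otimes> (P : a)\<close> in \<open>(F \<otimes> P : a)\<close> is checked on pure tensors
  (\<open>tensor_colon_subset\<close>). For the converse (\<open>flat_colon_subset\<close>), multiplication by \<open>a\<close> induces an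
  injection \<open>M / (P : a) \<rightarrow> M / P\<close>, which stays injective after tensoring with \<open>F\<close>. If \<open>a z\<close> is in
  \<open>F \<otimes> P\<close>, the image of \<open>z\<close> in \<open>F \<otimes> M / (P : a)\<close> is sent to \<open>0\<close> by this injection, so it
  is \<open>0\<close>, and right exactness of the tensor product (\<open>tensor_right_exact\<close>) puts \<open>z\<close> into
  \<open>F \<otimes> (P : a)\<close>.

  Two points come from the encoding. Flatness speaks about test modules on one fixed type, whereas a
  quotient of \<open>M\<close> has elements of type \<open>'m set\<close>; replacing each coset by one of its elements
  realises the quotient on any type that contains \<open>'m\<close> (\<open>quotient_in_type\<close>). And the tensor
  product is a concrete quotient of a free module, so most of the work is to derive its usual
  handling: pure tensors span (\<open>pure_tensor_span\<close>), linear maps can be defined by bilinear ones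
  (\<open>tensor_hom_lift\<close>), and \<open>F \<otimes> P\<close> is the submodule spanned by the tensors \<open>f \<otimes> p\<close>
  (\<open>tensor_submodule_least\<close>).
\<close>

section \<open>Linear maps, submodules and quotients\<close>

lemma module_homI:
  assumes "\<And>x. x \<in> carrier N \<Longrightarrow> g x \<in> carrier M"
    and "\<And>x y. x \<in> carrier N \<Longrightarrow> y \<in> carrier N \<Longrightarrow> g (x \<oplus>\<^bsub>N\<^esub> y) = g x \<oplus>\<^bsub>M\<^esub> g y"
    and "\<And>a x. a \<in> carrier A \<Longrightarrow> x \<in> carrier N \<Longrightarrow> g (a \<odot>\<^bsub>N\<^esub> x) = a \<odot>\<^bsub>M\<^esub> g x"
  shows "g \<in> module_hom A N M"
  using assms by (auto simp: module_hom_def hom_def)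

lemma
  assumes "g \<in> module_hom A N M"
  shows module_hom_closed: "x \<in> carrier N \<Longrightarrow> g x \<in> carrier M"
    and module_hom_add:
      "x \<in> carrier N \<Longrightarrow> y \<in> carrier N \<Longrightarrow> g (x \<oplus>\<^bsub>N\<^esub> y) = g x \<oplus>\<^bsub>M\<^esub> g y"
    and module_hom_smult:
      "a \<in> carrier A \<Longrightarrow> x \<in> carrier N \<Longrightarrow> g (a \<odot>\<^bsub>N\<^esub> x) = a \<odot>\<^bsub>M\<^esub> g x"
  using assms by (auto simp: module_hom_def hom_def)

lemma module_hom_zero:
  assumes "module A N" "module A M" "g \<in> module_hom A N M"
  shows "g \<zero>\<^bsub>N\<^esub> = \<zero>\<^bsub>M\<^esub>"
proof -
  interpret N: module A N by fact
  interpret M: module A M by fact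
  have "g (\<zero>\<^bsub>A\<^esub> \<odot>\<^bsub>N\<^esub> \<zero>\<^bsub>N\<^esub>) = \<zero>\<^bsub>A\<^esub> \<odot>\<^bsub>M\<^esub> g \<zero>\<^bsub>N\<^esub>"
    by (intro module_hom_smult[OF assms(3)]) simp_all
  then show ?thesis using module_hom_closed[OF assms(3), of "\<zero>\<^bsub>N\<^esub>"] by simp
qed

lemma module_hom_a_inv:
  assumes "module A N" "module A M" "g \<in> module_hom A N M" "x \<in> carrier N"
  shows "g (\<ominus>\<^bsub>N\<^esub> x) = \<ominus>\<^bsub>M\<^esub> g x"
proof -
  interpret N: module A N by fact
  interpret M: module A M by fact
  note c = module_hom_closed[OF assms(3)]
  have "g (\<ominus>\<^bsub>N\<^esub> x) \<oplus>\<^bsub>M\<^esub> g x = \<zero>\<^bsub>M\<^esub>"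
    using module_hom_add[OF assms(3), of "\<ominus>\<^bsub>N\<^esub> x" x] assms(4)
      module_hom_zero[OF assms(1-3)] by (simp add: N.l_neg)
  then show ?thesis using c[of x] c[of "\<ominus>\<^bsub>N\<^esub> x"] assms(4) by (simp add: M.minus_equality)
qed

lemma module_hom_minus:
  assumes "module A N" "module A M" "g \<in> module_hom A N M" "x \<in> carrier N" "y \<in> carrier N"
  shows "g (x \<ominus>\<^bsub>N\<^esub> y) = g x \<ominus>\<^bsub>M\<^esub> g y"
proof -
  interpret N: module A N by fact
  show ?thesis using assms
    by (simp add: a_minus_def module_hom_add[OF assms(3)] module_hom_a_inv)
qed

lemma module_hom_comp:
  assumes "g \<in> module_hom A N M" "h \<in> module_hom A M L"
  shows "(\<lambda>x. h (g x)) \<in> module_hom A N L"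
  by (rule module_homI)
    (simp_all add: module_hom_closed[OF assms(1)] module_hom_closed[OF assms(2)]
      module_hom_add[OF assms(1)] module_hom_add[OF assms(2)]
      module_hom_smult[OF assms(1)] module_hom_smult[OF assms(2)])

lemma module_hom_scale:
  assumes "module A M" "g \<in> module_hom A N M" "a \<in> carrier A"
  shows "(\<lambda>x. a \<odot>\<^bsub>M\<^esub> g x) \<in> module_hom A N M"
proof -
  interpret M: module A M by fact
  show ?thesis
  proof (rule module_homI)
    fix b x assume "b \<in> carrier A" "x \<in> carrier N"
    then show "a \<odot>\<^bsub>M\<^esub> g (b \<odot>\<^bsub>N\<^esub> x) = b \<odot>\<^bsub>M\<^esub> (a \<odot>\<^bsub>M\<^esub> g x)"
      using assms(3) module_hom_closed[OF assms(2)] module_hom_smult[OF assms(2)]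
      by (metis M.m_comm M.smult_assoc1)
  qed (use assms module_hom_closed[OF assms(2)] module_hom_add[OF assms(2)] in
        \<open>auto simp: M.smult_r_distr\<close>)
qed

lemma submodule_vimage:
  assumes "module A N" "module A M" "g \<in> module_hom A N M" "submodule H A M"
  shows "submodule {x \<in> carrier N. g x \<in> H} A N"
proof -
  interpret N: module A N by fact
  interpret M: module A M by fact
  interpret H: submodule H A M by fact
  show ?thesis
    using module_hom_zero[OF assms(1-3)] module_hom_a_inv[OF assms(1-3)]
      module_hom_add[OF assms(3)] module_hom_smult[OF assms(3)] M.submoduleE[OF assms(4)]
      H.one_closed
    by (intro N.submoduleI) auto
qed

lemma submodule_image:
  assumes "module A N" "module A M" "g \<in> module_hom A N M"
  shows "submodule (g ` carrier N) A M"
proof -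
  interpret N: module A N by fact
  interpret M: module A M by fact
  show ?thesis
  proof (rule M.submoduleI)
    show "\<zero>\<^bsub>M\<^esub> \<in> g ` carrier N"
      using module_hom_zero[OF assms] N.zero_closed by force
    show "\<ominus>\<^bsub>M\<^esub> y \<in> g ` carrier N" if "y \<in> g ` carrier N" for y
      using that by (auto simp flip: module_hom_a_inv[OF assms])
    show "y \<oplus>\<^bsub>M\<^esub> y' \<in> g ` carrier N" if "y \<in> g ` carrier N" "y' \<in> g ` carrier N" for y y'
      using that by (auto simp flip: module_hom_add[OF assms(3)])
    show "a \<odot>\<^bsub>M\<^esub> y \<in> g ` carrier N" if "a \<in> carrier A" "y \<in> g ` carrier N" for a y
      using that by (auto simp flip: module_hom_smult[OF assms(3)])
  qed (use module_hom_closed[OF assms(3)] in auto)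
qed

lemma submodule_zero:
  assumes "module A M"
  shows "submodule {\<zero>\<^bsub>M\<^esub>} A M"
proof -
  interpret M: module A M by fact
  show ?thesis by (rule M.submoduleI) auto
qed

lemma submodule_equalizer:
  assumes "module A N" "module A M" "g \<in> module_hom A N M" "h \<in> module_hom A N M"
  shows "submodule {x \<in> carrier N. g x = h x} A N"
proof -
  interpret N: module A N by fact
  show ?thesis
    by (rule N.submoduleI)
      (auto simp: module_hom_zero[OF assms(1,2)] module_hom_a_inv[OF assms(1,2)] assms(3,4)
        module_hom_add[OF assms(3)] module_hom_smult[OF assms(3)]
        module_hom_add[OF assms(4)] module_hom_smult[OF assms(4)])
qed

text \<open>The module laws are equations, so they pass from a module to any structure onto which it maps
  compatibly with the operations; the image of an inverse is an inverse. Quotients and transported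
  copies of modules are modules for this reason.\<close>

lemma module_surj_image:
  assumes "module A M" and q: "q \<in> module_hom A M N"
    and surj: "q ` carrier M = carrier N" and zero: "q \<zero>\<^bsub>M\<^esub> = \<zero>\<^bsub>N\<^esub>"
  shows "module A N"
proof -
  interpret M: module A M by fact
  note add = module_hom_add[OF q, symmetric] and smult = module_hom_smult[OF q, symmetric]
  show ?thesis
  proof (rule moduleI)
    show "cring A" by (rule M.R.is_cring)
    show "abelian_group N"
    proof (rule abelian_groupI; unfold surj[symmetric] zero[symmetric])
      show "\<exists>z\<in>q ` carrier M. z \<oplus>\<^bsub>N\<^esub> y = q \<zero>\<^bsub>M\<^esub>" if y: "y \<in> q ` carrier M" for y
      proof -
        obtain x where "x \<in> carrier M" "y = q x" using y by blast
        then show ?thesis by (intro bexI[of _ "q (\<ominus>\<^bsub>M\<^esub> x)"]) (auto simp: add M.l_neg)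
      qed
    qed (auto simp: add M.a_ac)
  qed (unfold surj[symmetric], auto simp: add smult M.smult_l_distr M.smult_r_distr M.smult_assoc1)
qed

lemma (in abelian_group) minus_eq_zero_iff:
  assumes "a \<in> carrier G" "b \<in> carrier G"
  shows "a \<ominus> b = \<zero> \<longleftrightarrow> a = b"
  using assms by (metis a_minus_def a_inv_closed minus_equality minus_minus r_neg)

lemma module_hom_factor:
  assumes "module A M" "module A N" "module A L"
    and q: "q \<in> module_hom A M N" and surj: "q ` carrier M = carrier N"
    and h: "h \<in> module_hom A M L"
    and ker: "\<And>x. x \<in> carrier M \<Longrightarrow> q x = \<zero>\<^bsub>N\<^esub> \<Longrightarrow> h x = \<zero>\<^bsub>L\<^esub>"
  obtains k where "k \<in> module_hom A N L" "\<And>x. x \<in> carrier M \<Longrightarrow> k (q x) = h x"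
proof
  interpret M: module A M by fact
  interpret N: module A N by fact
  interpret L: module A L by fact
  define k where "k y = h (inv_into (carrier M) q y)" for y
  show kq: "k (q x) = h x" if x: "x \<in> carrier M" for x
  proof -
    let ?x = "inv_into (carrier M) q (q x)"
    have x': "?x \<in> carrier M" "q ?x = q x"
      using x by (auto intro: inv_into_into f_inv_into_f)
    then have "q (?x \<ominus>\<^bsub>M\<^esub> x) = \<zero>\<^bsub>N\<^esub>"
      using x module_hom_closed[OF q]
      by (simp add: module_hom_minus[OF assms(1,2) q] N.minus_eq_zero_iff)
    then have "h ?x \<ominus>\<^bsub>L\<^esub> h x = \<zero>\<^bsub>L\<^esub>"
      using ker x x' by (simp flip: module_hom_minus[OF assms(1,3) h])
    then show ?thesis
      using x x' module_hom_closed[OF h] by (simp add: k_def L.minus_eq_zero_iff)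
  qed
  show "k \<in> module_hom A N L"
    by (rule module_homI; unfold surj[symmetric])
      (auto simp: kq module_hom_closed[OF h] module_hom_add[OF h] module_hom_smult[OF h]
        simp flip: module_hom_add[OF q] module_hom_smult[OF q])
qed

lemma module_hom_injI:
  assumes "module A N" "module A M" "g \<in> module_hom A N M"
    and "\<And>x. x \<in> carrier N \<Longrightarrow> g x = \<zero>\<^bsub>M\<^esub> \<Longrightarrow> x = \<zero>\<^bsub>N\<^esub>"
  shows "inj_on g (carrier N)"
proof (rule inj_onI)
  interpret N: module A N by fact
  interpret M: module A M by fact
  fix x y assume xy: "x \<in> carrier N" "y \<in> carrier N" "g x = g y"
  then have "g (x \<ominus>\<^bsub>N\<^esub> y) = \<zero>\<^bsub>M\<^esub>"
    using module_hom_closed[OF assms(3)]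
    by (simp add: module_hom_minus[OF assms(1-3)] M.minus_eq_zero_iff)
  then have "x \<ominus>\<^bsub>N\<^esub> y = \<zero>\<^bsub>N\<^esub>" using assms(4) xy by simp
  then show "x = y" using xy by (simp add: N.minus_eq_zero_iff)
qed

lemma submodule_imp_abelian_subgroup:
  assumes "module A M" "submodule H A M"
  shows "abelian_subgroup H M"
  using assms by (intro abelian_subgroupI3 additive_subgroupI)
    (auto simp: module_def submodule_def)

lemma coset_smult:
  assumes "module A M" "submodule H A M" "a \<in> carrier A" "x \<in> carrier M"
  shows "(\<Union>y\<in>H +>\<^bsub>M\<^esub> x. H +>\<^bsub>M\<^esub> (a \<odot>\<^bsub>M\<^esub> y)) = H +>\<^bsub>M\<^esub> (a \<odot>\<^bsub>M\<^esub> x)"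
proof -
  interpret M: module A M by fact
  interpret H: abelian_subgroup H M by (rule submodule_imp_abelian_subgroup) fact+
  have "H +>\<^bsub>M\<^esub> (a \<odot>\<^bsub>M\<^esub> y) = H +>\<^bsub>M\<^esub> (a \<odot>\<^bsub>M\<^esub> x)" if y: "y \<in> H +>\<^bsub>M\<^esub> x" for y
  proof -
    obtain h where h: "h \<in> H" "y = h \<oplus>\<^bsub>M\<^esub> x" using y by (auto simp: a_r_coset_def')
    then have "a \<odot>\<^bsub>M\<^esub> y \<in> H +>\<^bsub>M\<^esub> (a \<odot>\<^bsub>M\<^esub> x)"
      using assms M.submoduleE(4)[OF assms(2)] H.a_subset
      by (auto simp: a_r_coset_def' M.smult_r_distr)
    then show ?thesis
      using assms by (simp add: M.a_repr_independence[OF _ _ H.a_subgroup])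
  qed
  then show ?thesis using H.a_rcos_self[OF assms(4)] by blast
qed

lemma
  assumes "module A M" "submodule H A M"
  shows quotient_module_carrier:
      "carrier (quotient_module M H) = (\<lambda>x. H +>\<^bsub>M\<^esub> x) ` carrier M"
    and quotient_module_proj:
      "(\<lambda>x. H +>\<^bsub>M\<^esub> x) \<in> module_hom A M (quotient_module M H)"
    and quotient_module_module: "module A (quotient_module M H)"
    and quotient_module_ker:
      "x \<in> carrier M \<Longrightarrow> H +>\<^bsub>M\<^esub> x = \<zero>\<^bsub>quotient_module M H\<^esub> \<longleftrightarrow> x \<in> H"
proof -
  interpret M: module A M by fact
  interpret H: abelian_subgroup H M by (rule submodule_imp_abelian_subgroup) fact+
  show carr: "carrier (quotient_module M H) = (\<lambda>x. H +>\<^bsub>M\<^esub> x) ` carrier M"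
    by (auto simp: quotient_module_def A_RCOSETS_def')
  show proj: "(\<lambda>x. H +>\<^bsub>M\<^esub> x) \<in> module_hom A M (quotient_module M H)"
    by (rule module_homI, unfold carr)
      (simp_all add: quotient_module_def H.a_rcos_sum coset_smult[OF assms])
  show "module A (quotient_module M H)"
    by (rule module_surj_image[OF assms(1) proj])
      (simp_all add: carr, simp add: quotient_module_def H.a_subset)
  show "x \<in> carrier M \<Longrightarrow> H +>\<^bsub>M\<^esub> x = \<zero>\<^bsub>quotient_module M H\<^esub> \<longleftrightarrow> x \<in> H"
    using M.a_coset_join1[OF _ _ H.a_subgroup] M.a_coset_join2[OF _ H.a_subgroup]
    by (auto simp: quotient_module_def)
qed

lemma module_transport:
  fixes N :: "('a, 'n, 'x) module_scheme" and \<iota> :: "'n \<Rightarrow> 'q"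
  assumes "module A N" "inj_on \<iota> (carrier N)"
  obtains Q :: "('a, 'q) module"
  where "module A Q" "\<iota> \<in> module_hom A N Q" "carrier Q = \<iota> ` carrier N"
proof
  interpret N: module A N by fact
  define r where "r = inv_into (carrier N) \<iota>"
  have r: "r (\<iota> x) = x" if "x \<in> carrier N" for x
    using that assms(2) by (simp add: r_def)
  define Q :: "('a, 'q) module" where
    "Q = \<lparr>carrier = \<iota> ` carrier N, mult = undefined, one = undefined, zero = \<iota> \<zero>\<^bsub>N\<^esub>,
      add = (\<lambda>x y. \<iota> (r x \<oplus>\<^bsub>N\<^esub> r y)), smult = (\<lambda>a x. \<iota> (a \<odot>\<^bsub>N\<^esub> r x))\<rparr>"
  show carr: "carrier Q = \<iota> ` carrier N" by (simp add: Q_def)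
  show hom: "\<iota> \<in> module_hom A N Q"
    by (rule module_homI) (simp_all add: Q_def r)
  show "module A Q"
    by (rule module_surj_image[OF assms(1) hom]) (simp_all add: Q_def)
qed

text \<open>A coset can be encoded by a chosen representative, since distinct cosets are disjoint. Hence
  \<open>M / K\<close> has a copy on every type \<open>'q\<close> into which the element type of \<open>M\<close> embeds.\<close>

lemma quotient_in_type:
  fixes M :: "('a, 'm, 'y) module_scheme" and \<kappa> :: "'m \<Rightarrow> 'q"
  assumes "module A M" "submodule K A M" "inj \<kappa>"
  obtains Q :: "('a, 'q) module" and q
  where "module A Q" "q \<in> module_hom A M Q" "q ` carrier M = carrier Q"
    "\<And>x. x \<in> carrier M \<Longrightarrow> q x = \<zero>\<^bsub>Q\<^esub> \<longleftrightarrow> x \<in> K"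
proof -
  interpret M: module A M by fact
  interpret K: abelian_subgroup K M by (rule submodule_imp_abelian_subgroup) fact+
  let ?N = "quotient_module M K"
  note carr = quotient_module_carrier[OF assms(1,2)] and proj = quotient_module_proj[OF assms(1,2)]
    and N = quotient_module_module[OF assms(1,2)] and ker = quotient_module_ker[OF assms(1,2)]
  interpret N: module A ?N by (rule N)
  have rep: "X = K +>\<^bsub>M\<^esub> (SOME y. y \<in> X)" if X: "X \<in> carrier ?N" for X
  proof -
    obtain x where x: "x \<in> carrier M" "X = K +>\<^bsub>M\<^esub> x" using X by (auto simp: carr)
    then have "(SOME y. y \<in> X) \<in> X" using K.a_rcos_self by (metis someI)
    then show ?thesis using x M.a_repr_independence[OF _ _ K.a_subgroup] by simp
  qed
  define \<iota> where "\<iota> X = \<kappa> (SOME y. y \<in> X)" for X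
  have inj: "inj_on \<iota> (carrier ?N)"
    by (rule inj_onI, simp add: \<iota>_def inj_eq[OF \<open>inj \<kappa>\<close>]) (metis rep)
  obtain Q :: "('a, 'q) module" where Q: "module A Q" "\<iota> \<in> module_hom A ?N Q"
      "carrier Q = \<iota> ` carrier ?N"
    using module_transport[OF N inj] by blast
  show thesis
  proof
    show "(\<lambda>x. \<iota> (K +>\<^bsub>M\<^esub> x)) \<in> module_hom A M Q" by (rule module_hom_comp[OF proj Q(2)])
    show "\<iota> (K +>\<^bsub>M\<^esub> x) = \<zero>\<^bsub>Q\<^esub> \<longleftrightarrow> x \<in> K" if "x \<in> carrier M" for x
      using ker[OF that] module_hom_zero[OF N Q(1,2)] inj_on_eq_iff[OF inj] N.zero_closed that
        module_hom_closed[OF proj that] by metis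
  qed (use Q carr in \<open>auto simp: image_image\<close>)
qed

section \<open>Free modules\<close>

lemma mem_free_module:
  "u \<in> carrier (free_module A S) \<longleftrightarrow>
    (\<forall>s. u s \<in> carrier A \<or> s \<notin> S) \<and> (\<forall>s. s \<notin> S \<longrightarrow> u s = \<zero>\<^bsub>A\<^esub>) \<and> finite {s. u s \<noteq> \<zero>\<^bsub>A\<^esub>}"
  by (auto simp: free_module_def)

lemma free_module_ops:
  "\<zero>\<^bsub>free_module A S\<^esub> = (\<lambda>s. \<zero>\<^bsub>A\<^esub>)"
  "u \<oplus>\<^bsub>free_module A S\<^esub> v = (\<lambda>s. u s \<oplus>\<^bsub>A\<^esub> v s)"
  "a \<odot>\<^bsub>free_module A S\<^esub> u = (\<lambda>s. a \<otimes>\<^bsub>A\<^esub> u s)"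
  by (simp_all add: free_module_def)

context cring
begin

lemma free_module_coeff: "u \<in> carrier (free_module R S) \<Longrightarrow> u s \<in> carrier R"
  by (metis mem_free_module zero_closed)

lemma free_module_module: "module R (free_module R S)"
proof (rule moduleI)
  note [simp] = free_module_ops
  let ?C = "free_module R S"
  show "cring R" by (rule is_cring)
  have add: "(\<lambda>s. u s \<oplus> v s) \<in> carrier ?C" if "u \<in> carrier ?C" "v \<in> carrier ?C" for u v
    unfolding mem_free_module
  proof (intro conjI)
    show "finite {s. u s \<oplus> v s \<noteq> \<zero>}"
      by (rule finite_subset[of _ "{s. u s \<noteq> \<zero>} \<union> {s. v s \<noteq> \<zero>}"])
        (use that in \<open>auto simp: mem_free_module\<close>)
  qed (use that free_module_coeff in \<open>auto simp: mem_free_module\<close>)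
  show smult: "a \<odot>\<^bsub>?C\<^esub> u \<in> carrier ?C" if "a \<in> carrier R" "u \<in> carrier ?C" for a u
    unfolding mem_free_module free_module_ops
  proof (intro conjI)
    show "finite {s. a \<otimes> u s \<noteq> \<zero>}"
      by (rule finite_subset[of _ "{s. u s \<noteq> \<zero>}"])
        (use that in \<open>auto simp: mem_free_module\<close>)
  qed (use that free_module_coeff in \<open>auto simp: mem_free_module\<close>)
  show "abelian_group ?C"
  proof (rule abelian_groupI)
    show "\<exists>v\<in>carrier ?C. v \<oplus>\<^bsub>?C\<^esub> u = \<zero>\<^bsub>?C\<^esub>" if "u \<in> carrier ?C" for u
      by (rule bexI[of _ "(\<ominus> \<one>) \<odot>\<^bsub>?C\<^esub> u"])
        (use that smult[of "\<ominus> \<one>" u] free_module_coeff[OF that] in \<open>auto simp: l_minus l_neg\<close>)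
  qed (use add in \<open>auto simp: free_module_coeff a_ac\<close>, simp add: mem_free_module)
qed (auto simp: free_module_ops free_module_coeff l_distr r_distr m_assoc)

lemma free_gen_closed: "s \<in> S \<Longrightarrow> free_gen R s \<in> carrier (free_module R S)"
  by (auto simp: mem_free_module free_gen_def)

text \<open>Induction on a finite set containing the support: clearing one coordinate of \<open>u\<close> changes it by a
  multiple of a generator.\<close>

lemma free_module_span:
  assumes H: "submodule H R (free_module R S)" and gen: "\<And>s. s \<in> S \<Longrightarrow> free_gen R s \<in> H"
  shows "carrier (free_module R S) \<subseteq> H"
proof
  note [simp] = free_module_ops
  interpret C: module R "free_module R S" by (rule free_module_module)
  note HE = C.submoduleE[OF H]
  fix u assume "u \<in> carrier (free_module R S)"
  moreover define B where "B = {s. u s \<noteq> \<zero>}"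
  ultimately have "finite B" "u \<in> carrier (free_module R S)" "{s. u s \<noteq> \<zero>} \<subseteq> B"
    by (auto simp: mem_free_module)
  then show "u \<in> H"
  proof (induction B arbitrary: u)
    case empty
    then have "u = \<zero>\<^bsub>free_module R S\<^esub>" by auto
    then show ?case using submodule.axioms(1)[OF H] subgroup.one_closed by fastforce
  next
    case (insert s B)
    let ?v = "u(s := \<zero>)"
    have v: "?v \<in> carrier (free_module R S)"
      using insert.prems(1) by (auto simp: mem_free_module elim: rev_finite_subset)
    have vH: "?v \<in> H" by (rule insert.IH[OF v]) (use insert.prems in auto)
    show ?case
    proof (cases "s \<in> S")
      case True
      have "u s \<odot>\<^bsub>free_module R S\<^esub> free_gen R s \<in> H"
        using HE(4) gen[OF True] free_module_coeff[OF insert.prems(1)] by blast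
      with vH have "?v \<oplus>\<^bsub>free_module R S\<^esub> u s \<odot>\<^bsub>free_module R S\<^esub> free_gen R s \<in> H"
        by (rule HE(5))
      also have "?v \<oplus>\<^bsub>free_module R S\<^esub> u s \<odot>\<^bsub>free_module R S\<^esub> free_gen R s = u"
        using free_module_coeff[OF insert.prems(1)] by (auto simp: free_gen_def fun_eq_iff)
      finally show ?thesis .
    next
      case False
      then have "?v = u" using insert.prems(1) by (auto simp: mem_free_module fun_eq_iff)
      then show ?thesis using vH by simp
    qed
  qed
qed

text \<open>The defining sum of \<open>free_map\<close> ranges over a set that depends on \<open>u\<close>; here the range can be any
  finite set containing the support, so that the sums for \<open>u\<close> and \<open>v\<close> can be added.\<close>

lemma free_map_eq_finsum:
  assumes u: "u \<in> carrier (free_module R S)" and B: "finite B" "{s. u s \<noteq> \<zero>} \<subseteq> B"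
  shows "free_map R \<phi> u t = (\<Oplus>s\<in>B. if \<phi> s = t then u s else \<zero>)"
  unfolding free_map_def
  by (rule add.finprod_mono_neutral_cong_left)
    (use B free_module_coeff[OF u] in auto)

lemma free_map_hom:
  assumes \<phi>: "\<And>s. s \<in> S \<Longrightarrow> \<phi> s \<in> T"
  shows "free_map R \<phi> \<in> module_hom R (free_module R S) (free_module R T)"
proof (rule module_homI)
  note [simp] = free_module_ops
  let ?C = "free_module R S"
  interpret C: module R ?C by (rule free_module_module)
  fix u assume u: "u \<in> carrier ?C"
  let ?B = "{s. u s \<noteq> \<zero>}"
  have fin: "finite ?B" and sub: "?B \<subseteq> S" using u by (auto simp: mem_free_module)
  note uc [simp] = free_module_coeff[OF u]
  have nz: "t \<in> \<phi> ` ?B" if "free_map R \<phi> u t \<noteq> \<zero>" for t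
  proof (rule ccontr)
    assume "t \<notin> \<phi> ` ?B"
    then have e: "{s. u s \<noteq> \<zero> \<and> \<phi> s = t} = {}" by auto
    show False using that unfolding free_map_def e by simp
  qed
  show "free_map R \<phi> u \<in> carrier (free_module R T)"
    unfolding mem_free_module
  proof (intro conjI allI impI)
    show "finite {t. free_map R \<phi> u t \<noteq> \<zero>}"
      by (rule finite_subset[of _ "\<phi> ` ?B"]) (use nz fin in auto)
    show "free_map R \<phi> u t = \<zero>" if "t \<notin> T" for t
      using nz[of t] \<phi> sub that by blast
    show "free_map R \<phi> u t \<in> carrier R \<or> t \<notin> T" for t
      by (auto simp: free_map_def intro!: finsum_closed)
  qed
  show "free_map R \<phi> (a \<odot>\<^bsub>?C\<^esub> u) = a \<odot>\<^bsub>free_module R T\<^esub> free_map R \<phi> u"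
    if a: "a \<in> carrier R" for a
  proof
    fix t
    have "free_map R \<phi> (a \<odot>\<^bsub>?C\<^esub> u) t = (\<Oplus>s\<in>?B. if \<phi> s = t then (a \<odot>\<^bsub>?C\<^esub> u) s else \<zero>)"
      by (rule free_map_eq_finsum[OF C.smult_closed[OF a u]]) (use fin a in auto)
    also have "\<dots> = (\<Oplus>s\<in>?B. a \<otimes> (if \<phi> s = t then u s else \<zero>))"
      by (rule finsum_cong') (use a in auto)
    also have "\<dots> = a \<otimes> (\<Oplus>s\<in>?B. if \<phi> s = t then u s else \<zero>)"
      by (rule finsum_rdistr[symmetric]) (use a fin in auto)
    also have "\<dots> = a \<otimes> free_map R \<phi> u t"
      by (simp add: free_map_eq_finsum[OF u fin order_refl])
    finally show "free_map R \<phi> (a \<odot>\<^bsub>?C\<^esub> u) t = (a \<odot>\<^bsub>free_module R T\<^esub> free_map R \<phi> u) t"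
      by simp
  qed
  fix v assume v: "v \<in> carrier ?C"
  let ?D = "?B \<union> {s. v s \<noteq> \<zero>}"
  have finD: "finite ?D" using fin v by (auto simp: mem_free_module)
  note vc [simp] = free_module_coeff[OF v]
  show "free_map R \<phi> (u \<oplus>\<^bsub>?C\<^esub> v) = free_map R \<phi> u \<oplus>\<^bsub>free_module R T\<^esub> free_map R \<phi> v"
  proof
    fix t
    have "free_map R \<phi> (u \<oplus>\<^bsub>?C\<^esub> v) t = (\<Oplus>s\<in>?D. if \<phi> s = t then (u \<oplus>\<^bsub>?C\<^esub> v) s else \<zero>)"
      by (rule free_map_eq_finsum[OF C.a_closed[OF u v] finD]) auto
    also have "\<dots> = (\<Oplus>s\<in>?D. (if \<phi> s = t then u s else \<zero>) \<oplus> (if \<phi> s = t then v s else \<zero>))"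
      by (rule finsum_cong') auto
    also have "\<dots> = (\<Oplus>s\<in>?D. if \<phi> s = t then u s else \<zero>) \<oplus> (\<Oplus>s\<in>?D. if \<phi> s = t then v s else \<zero>)"
      by (rule finsum_addf) auto
    also have "\<dots> = free_map R \<phi> u t \<oplus> free_map R \<phi> v t"
      by (simp add: free_map_eq_finsum[OF u finD] free_map_eq_finsum[OF v finD])
    finally show "free_map R \<phi> (u \<oplus>\<^bsub>?C\<^esub> v) t =
        (free_map R \<phi> u \<oplus>\<^bsub>free_module R T\<^esub> free_map R \<phi> v) t" by simp
  qed
qed

lemma free_map_gen: "free_map R \<phi> (free_gen R s) = free_gen R (\<phi> s)"
proof
  fix t
  have g: "free_gen R s \<in> carrier (free_module R UNIV)" by (rule free_gen_closed) simp
  have "free_map R \<phi> (free_gen R s) t = (\<Oplus>x\<in>{s}. if \<phi> x = t then free_gen R s x else \<zero>)"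
    by (rule free_map_eq_finsum[OF g]) (auto simp: free_gen_def)
  also have "\<dots> = free_gen R (\<phi> s) t"
    by (auto simp: free_gen_def)
  finally show "free_map R \<phi> (free_gen R s) t = free_gen R (\<phi> s) t" .
qed

end

section \<open>Tensor products\<close>

definition bilinear_map ::
  "('a, 'r) ring_scheme \<Rightarrow> ('a, 'f, 'x) module_scheme \<Rightarrow> ('a, 'm, 'y) module_scheme
    \<Rightarrow> ('a, 'n, 'z) module_scheme \<Rightarrow> ('f \<Rightarrow> 'm \<Rightarrow> 'n) \<Rightarrow> bool"
  where "bilinear_map A F M N \<beta> \<longleftrightarrow>
    (\<forall>f\<in>carrier F. \<beta> f \<in> module_hom A M N) \<and>
    (\<forall>m\<in>carrier M. (\<lambda>f. \<beta> f m) \<in> module_hom A F N)"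

lemma bilinear_map_comp_right:
  assumes "bilinear_map A F M N \<beta>" "g \<in> module_hom A L M"
  shows "bilinear_map A F L N (\<lambda>f l. \<beta> f (g l))"
  using assms module_hom_closed[OF assms(2)] by (auto simp: bilinear_map_def intro: module_hom_comp)

lemma bilinear_map_comp_left:
  assumes "bilinear_map A F M N \<beta>" "h \<in> module_hom A N L"
  shows "bilinear_map A F M L (\<lambda>f m. h (\<beta> f m))"
  using assms by (auto simp: bilinear_map_def intro: module_hom_comp)

definition tensor_class ::
  "('a, 'r) ring_scheme \<Rightarrow> ('a, 'f, 'x) module_scheme \<Rightarrow> ('a, 'm, 'y) module_scheme
    \<Rightarrow> ('f \<times> 'm \<Rightarrow> 'a) \<Rightarrow> ('f \<times> 'm \<Rightarrow> 'a) set"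
  where "tensor_class A F M u = tensor_ker A F M +>\<^bsub>tensor_free A F M\<^esub> u"

definition pure_tensor ::
  "('a, 'r) ring_scheme \<Rightarrow> ('a, 'f, 'x) module_scheme \<Rightarrow> ('a, 'm, 'y) module_scheme
    \<Rightarrow> 'f \<Rightarrow> 'm \<Rightarrow> ('f \<times> 'm \<Rightarrow> 'a) set"
  where "pure_tensor A F M f m = tensor_class A F M (free_gen A (f, m))"

lemma tensor_relsI:
  fixes A F M
  defines "C \<equiv> tensor_free A F M" and "e \<equiv> free_gen A"
  assumes "f \<in> carrier F" "m \<in> carrier M"
  shows "f' \<in> carrier F \<Longrightarrow>
      e (f \<oplus>\<^bsub>F\<^esub> f', m) \<ominus>\<^bsub>C\<^esub> (e (f, m) \<oplus>\<^bsub>C\<^esub> e (f', m)) \<in> tensor_rels A F M"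
    and "m' \<in> carrier M \<Longrightarrow>
      e (f, m \<oplus>\<^bsub>M\<^esub> m') \<ominus>\<^bsub>C\<^esub> (e (f, m) \<oplus>\<^bsub>C\<^esub> e (f, m')) \<in> tensor_rels A F M"
    and "a \<in> carrier A \<Longrightarrow>
      e (a \<odot>\<^bsub>F\<^esub> f, m) \<ominus>\<^bsub>C\<^esub> a \<odot>\<^bsub>C\<^esub> e (f, m) \<in> tensor_rels A F M"
    and "a \<in> carrier A \<Longrightarrow>
      e (f, a \<odot>\<^bsub>M\<^esub> m) \<ominus>\<^bsub>C\<^esub> a \<odot>\<^bsub>C\<^esub> e (f, m) \<in> tensor_rels A F M"
  using assms unfolding tensor_rels_def Let_def C_def e_def by blast+

lemma tensor_relsE:
  fixes A F M
  defines "C \<equiv> tensor_free A F M" and "e \<equiv> free_gen A"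
  assumes "r \<in> tensor_rels A F M"
  obtains
    f f' m where "f \<in> carrier F" "f' \<in> carrier F" "m \<in> carrier M"
      "r = e (f \<oplus>\<^bsub>F\<^esub> f', m) \<ominus>\<^bsub>C\<^esub> (e (f, m) \<oplus>\<^bsub>C\<^esub> e (f', m))"
  | f m m' where "f \<in> carrier F" "m \<in> carrier M" "m' \<in> carrier M"
      "r = e (f, m \<oplus>\<^bsub>M\<^esub> m') \<ominus>\<^bsub>C\<^esub> (e (f, m) \<oplus>\<^bsub>C\<^esub> e (f, m'))"
  | a f m where "a \<in> carrier A" "f \<in> carrier F" "m \<in> carrier M"
      "r = e (a \<odot>\<^bsub>F\<^esub> f, m) \<ominus>\<^bsub>C\<^esub> a \<odot>\<^bsub>C\<^esub> e (f, m)"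
  | a f m where "a \<in> carrier A" "f \<in> carrier F" "m \<in> carrier M"
      "r = e (f, a \<odot>\<^bsub>M\<^esub> m) \<ominus>\<^bsub>C\<^esub> a \<odot>\<^bsub>C\<^esub> e (f, m)"
  using assms unfolding tensor_rels_def Let_def C_def e_def by blast

locale tensor_factors = F: module A F + M: module A M
  for A :: "('a, 'r) ring_scheme" (structure)
    and F :: "('a, 'f, 'x) module_scheme" (structure)
    and M :: "('a, 'm, 'y) module_scheme" (structure)
begin

abbreviation "C \<equiv> tensor_free A F M"
abbreviation "T \<equiv> tensor A F M"
abbreviation gen :: "'f \<Rightarrow> 'm \<Rightarrow> 'f \<times> 'm \<Rightarrow> 'a" where "gen f m \<equiv> free_gen A (f, m)"

sublocale C: module A "tensor_free A F M"
  by (rule F.R.free_module_module)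

lemma gen_closed: "f \<in> carrier F \<Longrightarrow> m \<in> carrier M \<Longrightarrow> gen f m \<in> carrier C"
  by (rule F.R.free_gen_closed) simp

lemma tensor_rels_closed: "tensor_rels A F M \<subseteq> carrier C"
proof
  fix r assume "r \<in> tensor_rels A F M"
  then show "r \<in> carrier C"
    by (cases rule: tensor_relsE) (simp_all add: gen_closed)
qed

text \<open>Since the relations lie in the free module, some submodule contains them all. The hull of the
  relations is thus an intersection of a nonempty family, and hence itself a submodule.\<close>

lemma tensor_ker_submodule: "submodule (tensor_ker A F M) A C"
proof -
  let ?\<H> = "{H. submodule H A C \<and> tensor_rels A F M \<subseteq> H}"
  have ker: "tensor_ker A F M = \<Inter>?\<H>" by (simp add: tensor_ker_def hull_def)
  have "carrier C \<in> ?\<H>" using C.carrier_is_submodule tensor_rels_closed by simp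
  moreover have "\<zero>\<^bsub>C\<^esub> \<in> H" if "submodule H A C" for H
    using subgroup.one_closed[OF submodule.axioms(1)[OF that]] by simp
  ultimately show ?thesis
    unfolding ker
  proof (intro C.submoduleI)
    show "\<ominus>\<^bsub>C\<^esub> x \<in> \<Inter>?\<H>" if "x \<in> \<Inter>?\<H>" for x
      using that C.submoduleE(3) by blast
    show "x \<oplus>\<^bsub>C\<^esub> y \<in> \<Inter>?\<H>" if "x \<in> \<Inter>?\<H>" "y \<in> \<Inter>?\<H>" for x y
      using that C.submoduleE(5) by blast
    show "a \<odot>\<^bsub>C\<^esub> x \<in> \<Inter>?\<H>" if "a \<in> carrier A" "x \<in> \<Inter>?\<H>" for a x
      using that C.submoduleE(4) by blast
  qed blast+
qed

lemma tensor_module: "module A T"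
  unfolding tensor_def
  by (rule quotient_module_module[OF C.module_axioms tensor_ker_submodule])

sublocale T: module A "tensor A F M"
  by (rule tensor_module)

lemma tensor_class_hom: "tensor_class A F M \<in> module_hom A C T"
  unfolding tensor_def tensor_class_def[abs_def]
  by (rule quotient_module_proj[OF C.module_axioms tensor_ker_submodule])

lemma tensor_carrier: "carrier T = tensor_class A F M ` carrier C"
  unfolding tensor_def tensor_class_def[abs_def]
  by (rule quotient_module_carrier[OF C.module_axioms tensor_ker_submodule])

lemma tensor_class_eq_zero_iff:
  "u \<in> carrier C \<Longrightarrow> tensor_class A F M u = \<zero>\<^bsub>T\<^esub> \<longleftrightarrow> u \<in> tensor_ker A F M"
  unfolding tensor_def tensor_class_def
  by (rule quotient_module_ker[OF C.module_axioms tensor_ker_submodule])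

lemma tensor_class_eqI:
  assumes "u \<in> carrier C" "v \<in> carrier C" "u \<ominus>\<^bsub>C\<^esub> v \<in> tensor_rels A F M"
  shows "tensor_class A F M u = tensor_class A F M v"
proof -
  have "u \<ominus>\<^bsub>C\<^esub> v \<in> tensor_ker A F M"
    unfolding tensor_ker_def by (rule hull_inc[OF assms(3)])
  then have "tensor_class A F M u \<ominus>\<^bsub>T\<^esub> tensor_class A F M v = \<zero>\<^bsub>T\<^esub>"
    using assms(1,2) tensor_class_eq_zero_iff
    by (simp flip: module_hom_minus[OF C.module_axioms tensor_module tensor_class_hom])
  then show ?thesis
    using assms(1,2) module_hom_closed[OF tensor_class_hom] by (simp add: T.minus_eq_zero_iff)
qed

lemma pure_tensor_closed:
  "f \<in> carrier F \<Longrightarrow> m \<in> carrier M \<Longrightarrow> pure_tensor A F M f m \<in> carrier T"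
  unfolding pure_tensor_def by (rule module_hom_closed[OF tensor_class_hom gen_closed])

lemma bilinear_pure_tensor: "bilinear_map A F M T (pure_tensor A F M)"
proof -
  note cl = gen_closed C.a_closed C.smult_closed
  note add = module_hom_add[OF tensor_class_hom, symmetric]
    and smult = module_hom_smult[OF tensor_class_hom, symmetric]
  show ?thesis
    unfolding bilinear_map_def
  proof (intro conjI ballI module_homI)
    fix f m m' assume "f \<in> carrier F" "m \<in> carrier M" "m' \<in> carrier M"
    then show "pure_tensor A F M f (m \<oplus>\<^bsub>M\<^esub> m') =
        pure_tensor A F M f m \<oplus>\<^bsub>T\<^esub> pure_tensor A F M f m'"
      unfolding pure_tensor_def
      by (subst add) (simp_all add: cl tensor_class_eqI[OF _ _ tensor_relsI(2)])
  next
    fix f a m assume "f \<in> carrier F" "a \<in> carrier A" "m \<in> carrier M"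
    then show "pure_tensor A F M f (a \<odot>\<^bsub>M\<^esub> m) = a \<odot>\<^bsub>T\<^esub> pure_tensor A F M f m"
      unfolding pure_tensor_def
      by (subst smult) (simp_all add: cl tensor_class_eqI[OF _ _ tensor_relsI(4)])
  next
    fix m f f' assume "m \<in> carrier M" "f \<in> carrier F" "f' \<in> carrier F"
    then show "pure_tensor A F M (f \<oplus>\<^bsub>F\<^esub> f') m =
        pure_tensor A F M f m \<oplus>\<^bsub>T\<^esub> pure_tensor A F M f' m"
      unfolding pure_tensor_def
      by (subst add) (simp_all add: cl tensor_class_eqI[OF _ _ tensor_relsI(1)])
  next
    fix m a f assume "m \<in> carrier M" "a \<in> carrier A" "f \<in> carrier F"
    then show "pure_tensor A F M (a \<odot>\<^bsub>F\<^esub> f) m = a \<odot>\<^bsub>T\<^esub> pure_tensor A F M f m"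
      unfolding pure_tensor_def
      by (subst smult) (simp_all add: cl tensor_class_eqI[OF _ _ tensor_relsI(3)])
  qed (rule pure_tensor_closed; assumption)+
qed

lemma pure_tensor_span:
  assumes H: "submodule H A T"
    and pure: "\<And>f m. f \<in> carrier F \<Longrightarrow> m \<in> carrier M \<Longrightarrow> pure_tensor A F M f m \<in> H"
  shows "carrier T \<subseteq> H"
proof -
  have "carrier C \<subseteq> {u \<in> carrier C. tensor_class A F M u \<in> H}"
    by (rule F.R.free_module_span
        [OF submodule_vimage[OF C.module_axioms tensor_module tensor_class_hom H]])
      (use pure gen_closed in \<open>auto simp: pure_tensor_def\<close>)
  then show ?thesis by (auto simp: tensor_carrier)
qed

lemma tensor_hom_eqI:
  assumes "module A N" "h \<in> module_hom A T N" "k \<in> module_hom A T N"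
    and "\<And>f m. f \<in> carrier F \<Longrightarrow> m \<in> carrier M \<Longrightarrow>
      h (pure_tensor A F M f m) = k (pure_tensor A F M f m)"
    and "z \<in> carrier T"
  shows "h z = k z"
  using pure_tensor_span[OF submodule_equalizer[OF tensor_module assms(1-3)]]
    assms(4,5) pure_tensor_closed by auto

text \<open>Bilinearity of \<open>h\<close> on generators says exactly that \<open>h\<close> vanishes on the four kinds of
  relations, and the kernel of \<open>h\<close> is a submodule.\<close>

lemma tensor_ker_vanish:
  assumes N: "module A N" and h: "h \<in> module_hom A C N"
    and bil: "bilinear_map A F M N (\<lambda>f m. h (gen f m))"
    and u: "u \<in> tensor_ker A F M"
  shows "h u = \<zero>\<^bsub>N\<^esub>"
proof -
  interpret N: module A N by (rule N)
  note cl = gen_closed C.a_closed C.smult_closed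
  note hom = module_hom_minus[OF C.module_axioms N h] module_hom_add[OF h] module_hom_smult[OF h]
    module_hom_closed[OF h]
  have right: "h (gen f (m \<oplus>\<^bsub>M\<^esub> m')) = h (gen f m) \<oplus>\<^bsub>N\<^esub> h (gen f m')"
      "h (gen f (a \<odot>\<^bsub>M\<^esub> m)) = a \<odot>\<^bsub>N\<^esub> h (gen f m)"
    if "f \<in> carrier F" "m \<in> carrier M" "m' \<in> carrier M" "a \<in> carrier A" for f m m' a
    using bil that module_hom_add[of "\<lambda>m. h (gen f m)"] module_hom_smult[of "\<lambda>m. h (gen f m)"]
    unfolding bilinear_map_def by metis+
  have left: "h (gen (f \<oplus>\<^bsub>F\<^esub> f') m) = h (gen f m) \<oplus>\<^bsub>N\<^esub> h (gen f' m)"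
      "h (gen (a \<odot>\<^bsub>F\<^esub> f) m) = a \<odot>\<^bsub>N\<^esub> h (gen f m)"
    if "f \<in> carrier F" "f' \<in> carrier F" "m \<in> carrier M" "a \<in> carrier A" for f f' m a
    using bil that module_hom_add[of "\<lambda>f. h (gen f m)"] module_hom_smult[of "\<lambda>f. h (gen f m)"]
    unfolding bilinear_map_def by metis+
  have "h r = \<zero>\<^bsub>N\<^esub>" if "r \<in> tensor_rels A F M" for r
    using that
  proof (cases rule: tensor_relsE)
    case (1 f f' m)
    then show ?thesis using left(1)[OF 1(1-3) F.R.zero_closed] by (simp add: cl hom N.minus_eq_zero_iff)
  next
    case (2 f m m')
    then show ?thesis using right(1)[OF 2(1-3) F.R.zero_closed] by (simp add: cl hom N.minus_eq_zero_iff)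
  next
    case (3 a f m)
    then show ?thesis using left(2)[OF 3(2,2,3,1)] by (simp add: cl hom N.minus_eq_zero_iff)
  next
    case (4 a f m)
    then show ?thesis using right(2)[OF 4(2,3,3,1)] by (simp add: cl hom N.minus_eq_zero_iff)
  qed
  then have "tensor_rels A F M \<subseteq> {u \<in> carrier C. h u \<in> {\<zero>\<^bsub>N\<^esub>}}"
    using tensor_rels_closed by auto
  then have "tensor_ker A F M \<subseteq> {u \<in> carrier C. h u \<in> {\<zero>\<^bsub>N\<^esub>}}"
    unfolding tensor_ker_def
    by (rule hull_minimal) (rule submodule_vimage[OF C.module_axioms N h submodule_zero[OF N]])
  then show ?thesis using u by auto
qed

text \<open>The universal property of the tensor product, with the bilinear map given through its linear
  extension \<open>h\<close> to the free module. In the applications below \<open>h\<close> is a \<open>free_map\<close> followed by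
  projections.\<close>

lemma tensor_hom_lift:
  assumes N: "module A N" and h: "h \<in> module_hom A C N"
    and bil: "bilinear_map A F M N (\<lambda>f m. h (gen f m))"
  obtains k where "k \<in> module_hom A T N"
    "\<And>u. u \<in> carrier C \<Longrightarrow> k (tensor_class A F M u) = h u"
    "\<And>f m. f \<in> carrier F \<Longrightarrow> m \<in> carrier M \<Longrightarrow> k (pure_tensor A F M f m) = h (gen f m)"
  using module_hom_factor[OF C.module_axioms tensor_module N tensor_class_hom
      tensor_carrier[symmetric] h] tensor_ker_vanish[OF assms] tensor_class_eq_zero_iff gen_closed
  by (metis pure_tensor_def)

end

lemma
  assumes "module A F" "module A N" "module A M" and g: "g \<in> module_hom A N M"
  shows tensor_map_hom: "tensor_map A F M g \<in> module_hom A (tensor A F N) (tensor A F M)"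
    and tensor_map_pure: "\<And>f n. f \<in> carrier F \<Longrightarrow> n \<in> carrier N \<Longrightarrow>
      tensor_map A F M g (pure_tensor A F N f n) = pure_tensor A F M f (g n)"
proof -
  interpret N: tensor_factors A F N by (intro tensor_factors.intro assms)
  interpret M: tensor_factors A F M by (intro tensor_factors.intro assms)
  let ?\<phi> = "\<lambda>(f, n). (f, g n)"
  let ?h = "\<lambda>u. tensor_class A F M (free_map A ?\<phi> u)"
  have hom: "?h \<in> module_hom A N.C M.T"
    by (rule module_hom_comp[OF N.F.R.free_map_hom M.tensor_class_hom])
      (use module_hom_closed[OF g] in auto)
  have h_gen: "?h (N.gen f n) = pure_tensor A F M f (g n)" for f n
    by (simp add: N.F.R.free_map_gen pure_tensor_def)
  have "bilinear_map A F N M.T (\<lambda>f n. ?h (N.gen f n))"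
    unfolding h_gen by (rule bilinear_map_comp_right[OF M.bilinear_pure_tensor g])
  from N.tensor_hom_lift[OF M.tensor_module hom this]
  obtain k where k: "k \<in> module_hom A N.T M.T"
    "\<And>u. u \<in> carrier N.C \<Longrightarrow> k (tensor_class A F N u) = ?h u"
    "\<And>f n. f \<in> carrier F \<Longrightarrow> n \<in> carrier N \<Longrightarrow> k (pure_tensor A F N f n) = ?h (N.gen f n)"
    by blast
  interpret K: abelian_subgroup "tensor_ker A F N" N.C
    by (rule submodule_imp_abelian_subgroup[OF N.C.module_axioms N.tensor_ker_submodule])
  \<comment> \<open>The union defining \<open>tensor_map\<close> is over the representatives \<open>u\<close> of one class \<open>X\<close>, and all of them
    contribute the same class \<open>k X\<close>.\<close>
  have map_k: "tensor_map A F M g X = k X" if X: "X \<in> carrier N.T" for X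
  proof -
    have rep: "X = tensor_class A F N u \<and> u \<in> carrier N.C" if u: "u \<in> X" for u
    proof -
      obtain v where v: "v \<in> carrier N.C" "X = tensor_class A F N v"
        using X by (auto simp: N.tensor_carrier)
      then show ?thesis
        using u N.C.a_repr_independence[OF _ v(1) K.a_subgroup]
          N.C.a_r_coset_subset_G[OF K.a_subset v(1)]
        unfolding tensor_class_def by blast
    qed
    obtain v where "v \<in> carrier N.C" "X = tensor_class A F N v"
      using X by (auto simp: N.tensor_carrier)
    then have "v \<in> X" using K.a_rcos_self by (simp add: tensor_class_def)
    moreover have "?h u = k X" if "u \<in> X" for u using rep[OF that] k(2) by metis
    ultimately show ?thesis unfolding tensor_map_def tensor_class_def[symmetric] by blast
  qed
  show "tensor_map A F M g \<in> module_hom A N.T M.T"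
    by (rule module_homI)
      (simp_all add: map_k module_hom_closed[OF k(1)] module_hom_add[OF k(1)]
        module_hom_smult[OF k(1)])
  show "tensor_map A F M g (pure_tensor A F N f n) = pure_tensor A F M f (g n)"
    if "f \<in> carrier F" "n \<in> carrier N" for f n
    using that by (simp add: map_k N.pure_tensor_closed k(3) h_gen)
qed

context tensor_factors
begin

lemma
  assumes P: "submodule P A M"
  shows tensor_submodule_submodule: "submodule (tensor_submodule A F M P) A T"
    and pure_tensor_in_tensor_submodule:
      "\<And>f p. f \<in> carrier F \<Longrightarrow> p \<in> P \<Longrightarrow> pure_tensor A F M f p \<in> tensor_submodule A F M P"
    and tensor_submodule_least:
      "\<And>H. submodule H A T \<Longrightarrow>
        (\<And>f p. f \<in> carrier F \<Longrightarrow> p \<in> P \<Longrightarrow> pure_tensor A F M f p \<in> H) \<Longrightarrow>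
        tensor_submodule A F M P \<subseteq> H"
proof -
  let ?P = "M\<lparr>carrier := P\<rparr>"
  have mP: "module A ?P" by (rule submodule.submodule_is_module[OF P M.module_axioms])
  interpret P: tensor_factors A F ?P
    by (intro tensor_factors.intro F.module_axioms mP)
  have incl: "(\<lambda>p. p) \<in> module_hom A ?P M"
    using M.submoduleE(1)[OF P] by (intro module_homI) auto
  note map = tensor_map_hom[OF F.module_axioms mP M.module_axioms incl]
    and pure = tensor_map_pure[OF F.module_axioms mP M.module_axioms incl, simplified]
  show "submodule (tensor_submodule A F M P) A T"
    unfolding tensor_submodule_def by (rule submodule_image[OF P.tensor_module tensor_module map])
  show "pure_tensor A F M f p \<in> tensor_submodule A F M P" if "f \<in> carrier F" "p \<in> P" for f p
    unfolding tensor_submodule_def using that pure P.pure_tensor_closed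
    by (intro image_eqI[of _ _ "pure_tensor A F ?P f p"]) auto
  show "tensor_submodule A F M P \<subseteq> H"
    if H: "submodule H A T"
      and pureH: "\<And>f p. f \<in> carrier F \<Longrightarrow> p \<in> P \<Longrightarrow> pure_tensor A F M f p \<in> H" for H
  proof -
    have "carrier P.T \<subseteq> {z \<in> carrier P.T. tensor_map A F M (\<lambda>p. p) z \<in> H}"
      by (rule P.pure_tensor_span[OF submodule_vimage[OF P.tensor_module tensor_module map H]])
        (use pureH pure P.pure_tensor_closed in auto)
    then show ?thesis by (auto simp: tensor_submodule_def)
  qed
qed

text \<open>The nontrivial half of exactness of \<open>F \<otimes> K \<rightarrow> F \<otimes> M \<rightarrow> F \<otimes> Q\<close> at \<open>F \<otimes> M\<close>, for a
  surjection \<open>q : M \<rightarrow> Q\<close> with kernel in \<open>K\<close>. Let \<open>E\<close> be the quotient of \<open>F \<otimes> M\<close> by the image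
  of \<open>F \<otimes> K\<close>. The class of \<open>f \<otimes> m\<close> in \<open>E\<close> depends only on \<open>f\<close> and \<open>q m\<close>, so the projection
  onto \<open>E\<close> factors through \<open>F \<otimes> Q\<close>, and it kills whatever \<open>id \<otimes> q\<close> kills.\<close>

lemma tensor_right_exact:
  fixes q :: "'m \<Rightarrow> 'q" and Q :: "('a, 'q) module"
  assumes K: "submodule K A M" and Q: "module A Q"
    and q: "q \<in> module_hom A M Q" and surj: "q ` carrier M = carrier Q"
    and ker: "\<And>m. m \<in> carrier M \<Longrightarrow> q m = \<zero>\<^bsub>Q\<^esub> \<Longrightarrow> m \<in> K"
    and z: "z \<in> carrier T" "tensor_map A F Q q z = \<zero>\<^bsub>tensor A F Q\<^esub>"
  shows "z \<in> tensor_submodule A F M K"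
proof -
  interpret Q: tensor_factors A F Q by (intro tensor_factors.intro F.module_axioms Q)
  note TK = tensor_submodule_submodule[OF K]
  define E where "E = quotient_module T (tensor_submodule A F M K)"
  define \<kappa> where "\<kappa> x = tensor_submodule A F M K +>\<^bsub>T\<^esub> x" for x
  have E: "module A E" unfolding E_def by (rule quotient_module_module[OF tensor_module TK])
  interpret E: module A E by (rule E)
  have \<kappa>: "\<kappa> \<in> module_hom A T E"
    unfolding E_def \<kappa>_def[abs_def] by (rule quotient_module_proj[OF tensor_module TK])
  have \<kappa>_zero: "\<kappa> x = \<zero>\<^bsub>E\<^esub> \<longleftrightarrow> x \<in> tensor_submodule A F M K" if "x \<in> carrier T" for x
    unfolding E_def \<kappa>_def using quotient_module_ker[OF tensor_module TK that] .
  \<comment> \<open>A set-theoretic section of \<open>q\<close>. It need not be linear, but it becomes so up to elements of \<open>K\<close>,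
    which are invisible in \<open>E\<close>.\<close>
  define s where "s = inv_into (carrier M) q"
  have s: "s y \<in> carrier M" "q (s y) = y" if "y \<in> carrier Q" for y
    using that surj by (auto simp: s_def inv_into_into f_inv_into_f)
  let ?\<beta> = "\<lambda>f m. \<kappa> (pure_tensor A F M f m)"
  have bil: "bilinear_map A F M E ?\<beta>"
    by (rule bilinear_map_comp_left[OF bilinear_pure_tensor \<kappa>])
  have \<beta>_right: "?\<beta> f \<in> module_hom A M E" if "f \<in> carrier F" for f
    using bil that by (simp add: bilinear_map_def)
  have \<beta>_cong: "?\<beta> f m = ?\<beta> f m'"
    if f: "f \<in> carrier F" and m: "m \<in> carrier M" "m' \<in> carrier M" and eq: "q m = q m'" for f m m'
  proof -
    have "q (m \<ominus>\<^bsub>M\<^esub> m') = \<zero>\<^bsub>Q\<^esub>"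
      using m eq module_hom_closed[OF q]
      by (simp add: module_hom_minus[OF M.module_axioms Q q] Q.M.minus_eq_zero_iff)
    then have "?\<beta> f (m \<ominus>\<^bsub>M\<^esub> m') = \<zero>\<^bsub>E\<^esub>"
      using ker m f pure_tensor_in_tensor_submodule[OF K] by (simp add: \<kappa>_zero pure_tensor_closed)
    then show ?thesis
      using m module_hom_closed[OF \<beta>_right[OF f]]
      by (simp add: module_hom_minus[OF M.module_axioms E \<beta>_right[OF f]] E.minus_eq_zero_iff)
  qed
  define h where "h u = \<kappa> (tensor_class A F M (free_map A (\<lambda>(f, y). (f, s y)) u))" for u
  have h: "h \<in> module_hom A Q.C E"
    unfolding h_def[abs_def]
    by (intro module_hom_comp[OF _ \<kappa>] module_hom_comp[OF _ tensor_class_hom] F.R.free_map_hom)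
      (use s in auto)
  have h_gen: "h (Q.gen f y) = ?\<beta> f (s y)" for f y
    by (simp add: h_def F.R.free_map_gen pure_tensor_def)
  have "bilinear_map A F Q E (\<lambda>f y. ?\<beta> f (s y))"
    unfolding bilinear_map_def
  proof (intro conjI ballI)
    show "(\<lambda>f. ?\<beta> f (s y)) \<in> module_hom A F E" if "y \<in> carrier Q" for y
      using bil s(1)[OF that] by (simp add: bilinear_map_def)
    fix f assume f: "f \<in> carrier F"
    show "(\<lambda>y. ?\<beta> f (s y)) \<in> module_hom A Q E"
    proof (rule module_homI)
      fix x y assume xy: "x \<in> carrier Q" "y \<in> carrier Q"
      have "?\<beta> f (s (x \<oplus>\<^bsub>Q\<^esub> y)) = ?\<beta> f (s x \<oplus>\<^bsub>M\<^esub> s y)"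
        by (rule \<beta>_cong[OF f]) (use xy s in \<open>simp_all add: module_hom_add[OF q]\<close>)
      then show "?\<beta> f (s (x \<oplus>\<^bsub>Q\<^esub> y)) = ?\<beta> f (s x) \<oplus>\<^bsub>E\<^esub> ?\<beta> f (s y)"
        using xy s by (simp add: module_hom_add[OF \<beta>_right[OF f]])
    next
      fix a x assume ax: "a \<in> carrier A" "x \<in> carrier Q"
      have "?\<beta> f (s (a \<odot>\<^bsub>Q\<^esub> x)) = ?\<beta> f (a \<odot>\<^bsub>M\<^esub> s x)"
        by (rule \<beta>_cong[OF f]) (use ax s in \<open>simp_all add: module_hom_smult[OF q]\<close>)
      then show "?\<beta> f (s (a \<odot>\<^bsub>Q\<^esub> x)) = a \<odot>\<^bsub>E\<^esub> ?\<beta> f (s x)"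
        using ax s by (simp add: module_hom_smult[OF \<beta>_right[OF f]])
    qed (use s module_hom_closed[OF \<beta>_right[OF f]] in auto)
  qed
  then have bil': "bilinear_map A F Q E (\<lambda>f y. h (Q.gen f y))"
    by (simp only: h_gen)
  obtain k where k: "k \<in> module_hom A Q.T E"
      "\<And>u. u \<in> carrier Q.C \<Longrightarrow> k (tensor_class A F Q u) = h u"
      "\<And>f y. f \<in> carrier F \<Longrightarrow> y \<in> carrier Q \<Longrightarrow>
        k (pure_tensor A F Q f y) = h (Q.gen f y)"
    using Q.tensor_hom_lift[OF E h bil'] by blast
  note map = tensor_map_hom[OF F.module_axioms M.module_axioms Q q]
    and map_pure = tensor_map_pure[OF F.module_axioms M.module_axioms Q q]
  have "k (tensor_map A F Q q z) = \<kappa> z"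
  proof (rule tensor_hom_eqI[OF E module_hom_comp[OF map k(1)] \<kappa> _ z(1)])
    fix f m assume fm: "f \<in> carrier F" "m \<in> carrier M"
    then have "k (tensor_map A F Q q (pure_tensor A F M f m)) = ?\<beta> f (s (q m))"
      using module_hom_closed[OF q] by (simp add: map_pure k(3) h_gen)
    also have "\<dots> = ?\<beta> f m"
      by (rule \<beta>_cong) (use fm s module_hom_closed[OF q] in auto)
    finally show "k (tensor_map A F Q q (pure_tensor A F M f m)) = ?\<beta> f m" .
  qed
  then have "\<kappa> z = \<zero>\<^bsub>E\<^esub>"
    using z(2) module_hom_zero[OF Q.tensor_module E k(1)] by simp
  then show ?thesis using \<kappa>_zero z(1) by simp
qed

end

section \<open>Colon submodules and flatness\<close>

definition colon ::
  "('a, 'm, 'y) module_scheme \<Rightarrow> 'm set \<Rightarrow> 'a \<Rightarrow> 'm set"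
  where "colon M P a = {m \<in> carrier M. a \<odot>\<^bsub>M\<^esub> m \<in> P}"

lemma scale_hom:
  assumes "module A M" "a \<in> carrier A"
  shows "(\<lambda>x. a \<odot>\<^bsub>M\<^esub> x) \<in> module_hom A M M"
  by (rule module_hom_scale[OF assms(1) _ assms(2)]) (auto intro: module_homI)

lemma colon_submodule:
  assumes "module A M" "submodule P A M" "a \<in> carrier A"
  shows "submodule (colon M P a) A M"
  unfolding colon_def
  by (rule submodule_vimage[OF assms(1,1) scale_hom[OF assms(1,3)] assms(2)])

text \<open>If \<open>x \<in> H\<close> is outside \<open>K\<close> and \<open>y \<in> H\<close> is outside \<open>L\<close>, then \<open>x \<in> L\<close> and \<open>y \<in> K\<close>, so
  the element \<open>x + y\<close> of \<open>H\<close> is in neither.\<close>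

lemma submodule_subset_Un:
  assumes "module A M" "submodule H A M" "submodule K A M" "submodule L A M" "H \<subseteq> K \<union> L"
  shows "H \<subseteq> K \<or> H \<subseteq> L"
proof (rule ccontr)
  interpret M: module A M by fact
  note HE = M.submoduleE[OF assms(2)] and KE = M.submoduleE[OF assms(3)]
    and LE = M.submoduleE[OF assms(4)]
  assume "\<not> (H \<subseteq> K \<or> H \<subseteq> L)"
  then obtain x y where x: "x \<in> H" "x \<notin> K" and y: "y \<in> H" "y \<notin> L" by blast
  with assms(5) have xL: "x \<in> L" and yK: "y \<in> K" by auto
  have xM: "x \<in> carrier M" and yM: "y \<in> carrier M" using x y HE(1) by auto
  have "x \<oplus>\<^bsub>M\<^esub> y \<in> K \<union> L" using HE(5) x y assms(5) by blast
  then show False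
  proof
    assume "x \<oplus>\<^bsub>M\<^esub> y \<in> K"
    then have "(x \<oplus>\<^bsub>M\<^esub> y) \<oplus>\<^bsub>M\<^esub> \<ominus>\<^bsub>M\<^esub> y \<in> K" using KE(3,5) yK by blast
    then show False using x(2) xM yM by (simp add: M.a_assoc M.r_neg)
  next
    assume "x \<oplus>\<^bsub>M\<^esub> y \<in> L"
    then have "\<ominus>\<^bsub>M\<^esub> x \<oplus>\<^bsub>M\<^esub> (x \<oplus>\<^bsub>M\<^esub> y) \<in> L" using LE(3,5) xL by blast
    then show False using y(2) xM yM by (simp add: M.r_neg1)
  qed
qed

context tensor_factors
begin

lemma tensor_submodule_mono:
  assumes "submodule P A M" "submodule P' A M" "P \<subseteq> P'"
  shows "tensor_submodule A F M P \<subseteq> tensor_submodule A F M P'"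
  using assms pure_tensor_in_tensor_submodule[OF assms(2)]
  by (intro tensor_submodule_least tensor_submodule_submodule) auto

lemma tensor_colon_subset:
  assumes P: "submodule P A M" and a: "a \<in> carrier A"
  shows "tensor_submodule A F M (colon M P a) \<subseteq> colon T (tensor_submodule A F M P) a"
proof (rule tensor_submodule_least)
  show "submodule (colon M P a) A M" by (rule colon_submodule[OF M.module_axioms P a])
  show "submodule (colon T (tensor_submodule A F M P) a) A T"
    by (rule colon_submodule[OF tensor_module tensor_submodule_submodule[OF P] a])
  fix f p assume f: "f \<in> carrier F" and p: "p \<in> colon M P a"
  have "pure_tensor A F M f \<in> module_hom A M T"
    using bilinear_pure_tensor f by (simp add: bilinear_map_def)
  from module_hom_smult[OF this a] p
  have "a \<odot>\<^bsub>T\<^esub> pure_tensor A F M f p = pure_tensor A F M f (a \<odot>\<^bsub>M\<^esub> p)"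
    by (simp add: colon_def)
  then show "pure_tensor A F M f p \<in> colon T (tensor_submodule A F M P) a"
    using p f pure_tensor_in_tensor_submodule[OF P] pure_tensor_closed by (simp add: colon_def)
qed

text \<open>Flatness is applied to the injection \<open>g : M / (P : a) \<rightarrow> M / P\<close> induced by multiplication by
  \<open>a\<close>. The embedding \<open>\<kappa>\<close> makes both quotients available on the type of the test modules.\<close>

lemma flat_colon_subset:
  assumes flat: "flat_module TYPE('q) A F" and \<kappa>: "inj (\<kappa> :: 'm \<Rightarrow> 'q)"
    and P: "submodule P A M" and a: "a \<in> carrier A"
  shows "colon T (tensor_submodule A F M P) a \<subseteq> tensor_submodule A F M (colon M P a)"
proof
  fix z assume "z \<in> colon T (tensor_submodule A F M P) a"
  then have z: "z \<in> carrier T" and az: "a \<odot>\<^bsub>T\<^esub> z \<in> tensor_submodule A F M P"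
    by (auto simp: colon_def)
  note Pa = colon_submodule[OF M.module_axioms P a]
  obtain Q :: "('a, 'q) module" and q where Q: "module A Q" and q: "q \<in> module_hom A M Q"
    and "q ` carrier M = carrier Q"
    and q_ker: "\<And>x. x \<in> carrier M \<Longrightarrow> q x = \<zero>\<^bsub>Q\<^esub> \<longleftrightarrow> x \<in> P"
    using quotient_in_type[OF M.module_axioms P \<kappa>] by blast
  obtain Q' :: "('a, 'q) module" and q' where Q': "module A Q'" and q': "q' \<in> module_hom A M Q'"
    and q'_surj: "q' ` carrier M = carrier Q'"
    and q'_ker: "\<And>x. x \<in> carrier M \<Longrightarrow> q' x = \<zero>\<^bsub>Q'\<^esub> \<longleftrightarrow> x \<in> colon M P a"
    using quotient_in_type[OF M.module_axioms Pa \<kappa>] by blast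
  interpret Q: tensor_factors A F Q by (intro tensor_factors.intro F.module_axioms Q)
  interpret Q': tensor_factors A F Q' by (intro tensor_factors.intro F.module_axioms Q')
  have qa: "(\<lambda>x. a \<odot>\<^bsub>Q\<^esub> q x) \<in> module_hom A M Q" by (rule module_hom_scale[OF Q q a])
  have qa_ker: "a \<odot>\<^bsub>Q\<^esub> q x = \<zero>\<^bsub>Q\<^esub> \<longleftrightarrow> x \<in> colon M P a" if "x \<in> carrier M" for x
    using that q_ker[of "a \<odot>\<^bsub>M\<^esub> x"] a module_hom_smult[OF q] by (simp add: colon_def)
  obtain g where g: "g \<in> module_hom A Q' Q"
    and gq': "\<And>x. x \<in> carrier M \<Longrightarrow> g (q' x) = a \<odot>\<^bsub>Q\<^esub> q x"
    using module_hom_factor[OF M.module_axioms Q' Q q' q'_surj qa] qa_ker q'_ker by metis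
  have "inj_on g (carrier Q')"
  proof (rule module_hom_injI[OF Q' Q g])
    fix y assume "y \<in> carrier Q'" "g y = \<zero>\<^bsub>Q\<^esub>"
    moreover obtain x where "x \<in> carrier M" "y = q' x"
      using q'_surj \<open>y \<in> carrier Q'\<close> by blast
    ultimately show "y = \<zero>\<^bsub>Q'\<^esub>" using gq' qa_ker q'_ker by metis
  qed
  then have inj: "inj_on (tensor_map A F Q g) (carrier Q'.T)"
    using flat Q Q' g unfolding flat_module_def by blast
  note mq = tensor_map_hom[OF F.module_axioms M.module_axioms Q q]
    and mq_pure = tensor_map_pure[OF F.module_axioms M.module_axioms Q q]
    and mq' = tensor_map_hom[OF F.module_axioms M.module_axioms Q' q']
    and mq'_pure = tensor_map_pure[OF F.module_axioms M.module_axioms Q' q']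
    and mg = tensor_map_hom[OF F.module_axioms Q' Q g]
    and mg_pure = tensor_map_pure[OF F.module_axioms Q' Q g]
  \<comment> \<open>Tensoring \<open>g \<circ> q' = a q\<close> with \<open>F\<close> shows that \<open>id \<otimes> g\<close> sends the image of \<open>z\<close> to that of
    \<open>a z\<close>, which is \<open>0\<close> since \<open>id \<otimes> q\<close> kills \<open>F \<otimes> P\<close>.\<close>
  have "tensor_map A F Q g (tensor_map A F Q' q' z) = a \<odot>\<^bsub>Q.T\<^esub> tensor_map A F Q q z"
  proof (rule tensor_hom_eqI[OF Q.tensor_module module_hom_comp[OF mq' mg]
        module_hom_scale[OF Q.tensor_module mq a] _ z])
    fix f m assume fm: "f \<in> carrier F" "m \<in> carrier M"
    have "pure_tensor A F Q f \<in> module_hom A Q Q.T"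
      using Q.bilinear_pure_tensor fm by (simp add: bilinear_map_def)
    then show "tensor_map A F Q g (tensor_map A F Q' q' (pure_tensor A F M f m)) =
        a \<odot>\<^bsub>Q.T\<^esub> tensor_map A F Q q (pure_tensor A F M f m)"
      using fm a module_hom_closed[OF q] module_hom_closed[OF q']
      by (simp add: mq_pure mq'_pure mg_pure gq' module_hom_smult)
  qed
  also have "\<dots> = tensor_map A F Q q (a \<odot>\<^bsub>T\<^esub> z)"
    using module_hom_smult[OF mq a z] by simp
  also have "\<dots> = \<zero>\<^bsub>Q.T\<^esub>"
  proof -
    have "tensor_submodule A F M P \<subseteq> {x \<in> carrier T. tensor_map A F Q q x \<in> {\<zero>\<^bsub>Q.T\<^esub>}}"
    proof (rule tensor_submodule_least[OF P])
      show "submodule {x \<in> carrier T. tensor_map A F Q q x \<in> {\<zero>\<^bsub>Q.T\<^esub>}} A T"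
        by (rule submodule_vimage[OF tensor_module Q.tensor_module mq
              submodule_zero[OF Q.tensor_module]])
      fix f p assume fp: "f \<in> carrier F" "p \<in> P"
      then have pM: "p \<in> carrier M" using M.submoduleE(1)[OF P] by blast
      have "pure_tensor A F Q f \<in> module_hom A Q Q.T"
        using Q.bilinear_pure_tensor fp by (simp add: bilinear_map_def)
      then have "pure_tensor A F Q f (q p) = \<zero>\<^bsub>Q.T\<^esub>"
        using module_hom_zero[OF Q Q.tensor_module] q_ker[OF pM] fp by simp
      then show "pure_tensor A F M f p \<in> {x \<in> carrier T. tensor_map A F Q q x \<in> {\<zero>\<^bsub>Q.T\<^esub>}}"
        using fp pM pure_tensor_closed by (simp add: mq_pure)
    qed
    then show ?thesis using az by blast
  qed
  also have "\<dots> = tensor_map A F Q g \<zero>\<^bsub>Q'.T\<^esub>"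
    using module_hom_zero[OF Q'.tensor_module Q.tensor_module mg] by simp
  finally have "tensor_map A F Q' q' z = \<zero>\<^bsub>Q'.T\<^esub>"
    using inj_onD[OF inj] module_hom_closed[OF mq' z] Q'.T.zero_closed by blast
  then show "z \<in> tensor_submodule A F M (colon M P a)"
    using tensor_right_exact[OF Pa Q' q' q'_surj _ z] q'_ker by blast
qed

end

text \<open>The alternative in the absorbing condition may depend on \<open>m\<close>; here it is chosen once for all
  \<open>m\<close>, which is what a passage to sums of pure tensors requires.\<close>

lemma (in classical_1_absorbing_prime_submodule) colon_dichotomy:
  assumes a: "a \<in> carrier A - Units A" and b: "b \<in> carrier A - Units A"
    and c: "c \<in> carrier A - Units A"
  shows "colon M P (a \<otimes>\<^bsub>A\<^esub> b \<otimes>\<^bsub>A\<^esub> c) \<subseteq> colon M P (a \<otimes>\<^bsub>A\<^esub> b) \<or>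
    colon M P (a \<otimes>\<^bsub>A\<^esub> b \<otimes>\<^bsub>A\<^esub> c) \<subseteq> colon M P c"
proof (rule submodule_subset_Un)
  have "submodule P A M" by (rule submodule_axioms)
  then show "submodule (colon M P (a \<otimes>\<^bsub>A\<^esub> b \<otimes>\<^bsub>A\<^esub> c)) A M"
      "submodule (colon M P (a \<otimes>\<^bsub>A\<^esub> b)) A M" "submodule (colon M P c) A M"
    using a b c by (simp_all add: colon_submodule[OF module_axioms])
  show "colon M P (a \<otimes>\<^bsub>A\<^esub> b \<otimes>\<^bsub>A\<^esub> c) \<subseteq> colon M P (a \<otimes>\<^bsub>A\<^esub> b) \<union> colon M P c"
    using absorbing[OF a b c] by (auto simp: colon_def)
qed (rule module_axioms)

theorem theorem7:
  fixes A :: "('a, 'r) ring_scheme"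
    and F :: "('a, 'f, 'x) module_scheme"
    and M :: "('a, 'm, 'y) module_scheme"
    and P :: "'m set"
  assumes "cring A" and "\<one>\<^bsub>A\<^esub> \<noteq> \<zero>\<^bsub>A\<^esub>"
    and "module A M" and "carrier M \<noteq> {\<zero>\<^bsub>M\<^esub>}"
    and "flat_module TYPE('a + 'm) A F" and "carrier F \<noteq> {\<zero>\<^bsub>F\<^esub>}"
    and "classical_1_absorbing_prime_submodule A M P"
    and "tensor_submodule A F M P \<noteq> carrier (tensor A F M)"
  shows "classical_1_absorbing_prime_submodule A (tensor A F M) (tensor_submodule A F M P)"
proof -
  have F: "module A F" using assms(5) by (simp add: flat_module_def)
  interpret P: classical_1_absorbing_prime_submodule A M P by (rule assms(7))
  interpret tensor_factors A F M by (intro tensor_factors.intro F assms(3))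
  have P: "submodule P A M" by (rule P.submodule_axioms)
  have colon_eq: "colon T (tensor_submodule A F M P) a = tensor_submodule A F M (colon M P a)"
    if "a \<in> carrier A" for a
    by (rule equalityI[OF flat_colon_subset[OF assms(5) inj_Inr P that]
          tensor_colon_subset[OF P that]])
  show ?thesis
  proof (intro classical_1_absorbing_prime_submodule.intro
      classical_1_absorbing_prime_submodule_axioms.intro tensor_module
      tensor_submodule_submodule[OF P] assms(8))
    fix a b c z
    assume a: "a \<in> carrier A - Units A" and b: "b \<in> carrier A - Units A"
      and c: "c \<in> carrier A - Units A" and z: "z \<in> carrier T"
      and abc: "(a \<otimes>\<^bsub>A\<^esub> b \<otimes>\<^bsub>A\<^esub> c) \<odot>\<^bsub>T\<^esub> z \<in> tensor_submodule A F M P"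
    have cl: "a \<otimes>\<^bsub>A\<^esub> b \<otimes>\<^bsub>A\<^esub> c \<in> carrier A" "a \<otimes>\<^bsub>A\<^esub> b \<in> carrier A" "c \<in> carrier A"
      using a b c by auto
    have "z \<in> tensor_submodule A F M (colon M P (a \<otimes>\<^bsub>A\<^esub> b \<otimes>\<^bsub>A\<^esub> c))"
      using z abc cl by (simp flip: colon_eq) (simp add: colon_def)
    moreover note sub = colon_submodule[OF assms(3) P]
    ultimately have "z \<in> tensor_submodule A F M (colon M P (a \<otimes>\<^bsub>A\<^esub> b)) \<or>
        z \<in> tensor_submodule A F M (colon M P c)"
      using P.colon_dichotomy[OF a b c] tensor_submodule_mono[OF sub sub] cl by blast
    then show "(a \<otimes>\<^bsub>A\<^esub> b) \<odot>\<^bsub>T\<^esub> z \<in> tensor_submodule A F M P \<or>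
        c \<odot>\<^bsub>T\<^esub> z \<in> tensor_submodule A F M P"
      using cl by (simp flip: colon_eq) (auto simp: colon_def)
  qed
qed

end
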